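(* Consider the interferers of a single cluster: their number $M$ is Poisson with mean $\lambda'>0$ and, given $M$, the normalized distances $r_{1,i},\dots,r_{M,i}$ from the interferers to receiver $Y_i$ ($i\in\{1,2\}$) are i.i.d. with density $$f_r(r\mid\nu)=\frac{r}{\sigma^2}\exp\left(-\frac{r^2+\nu^2}{2\sigma^2}\right)\mathcal I_0\left(\frac{r\nu}{\sigma^2}\right),\qquad r\ge 0,$$ where $\sigma>0$, $\nu\ge 0$ is the (relative) distance from the receiver to the cluster center, and $\mathcal I_0$ is the modified Bessel function of the first kind of order zero. Let all access probabilities be equal to $p\in[0,1]$. Then the spatially averaged second moment of the conditional outage probability is $$\mathbb E_{M,\boldsymbol r}[\epsilon_i^2(\boldsymbol r)]=2\,\mathbb E_{M,\boldsymbol r}[\epsilon_i(\boldsymbol r)]-1+\exp\left\{-\frac{2\beta}{\mathsf{SNR}}-\lambda'\left[1-\mathcal Q(\sigma)\right]\right\},$$ where $$\mathcal Q(\sigma)=\int_0^\infty f_r(r\mid\nu)\left(1-p+\frac{p\,r^\alpha}{\beta+r^\alpha}\right)^2dr=(1-p)^2+2(1-p)p\,\mathcal V(\sigma)+p^2\,\mathcal C(\sigma),$$ $$\mathcal V(\sigma)=\int_0^\infty\frac{r^\alpha}{\beta+r^\alpha}f_r(r\mid\nu)\,dr,\qquad \mathcal C(\sigma)=\int_0^\infty\frac{r^{2\alpha}}{(\beta+r^\alpha)^2}f_r(r\mid\nu)\,dr .$$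
   Context: Network model. A reference transmitter is at $X_0=0$ in the plane $\mathbb C$; two receivers are at $Y_1=r_0$ and $Y_2=r_0e^{\mathrm{i}\theta}$, $r_0>0$, $\theta\in\mathbb R$. There are $M$ interferers at positions $X_1,\dots,X_M$. Put $r_{i,j}=|X_i-Y_j|/r_0$ (normalized distance) and $\boldsymbol r=\{r_{i,j}\}_{1\le i\le M,\,j\in\{1,2\}}$. Constants: path-loss exponent $\alpha>0$, SINR threshold $\beta>0$, $\mathsf{SNR}>0$. The SINR at $Y_j$ is $$\gamma_j=\frac{g_{0,j}}{\mathsf{SNR}^{-1}+\sum_{i=1}^M I_i\,g_{i,j}\,r_{i,j}^{-\alpha}},$$ where the $g_{i,j}$ are i.i.d. unit-mean exponential random variables (Rayleigh fading), the $I_i$ are independent Bernoulli variables with $\mathbb P[I_i=1]=p_i$, and the $g$'s, the $I$'s and the positions are mutually independent. The conditional outage probability is $$\epsilon_j(\boldsymbol r)=\mathbb P[\gamma_j\le\beta\mid\boldsymbol r,M]=1-\exp\left(-\frac{\beta}{\mathsf{SNR}}\right)\prod_{i=1}^M\left(1-p_i+\frac{p_i\,r_{i,j}^\alpha}{\beta+r_{i,j}^\alpha}\right).$$ $\mathbb E_{M,\boldsymbol r}$ denotes expectation over both the number and the positions of the interferers. Cluster model (Thomas cluster process, intra-cluster interference only): the interferers are the offspring points of one cluster, displaced from the cluster center by independent symmetric two-dimensional normal vectors; the density $f_r(\cdot\mid\nu)$ above is the resulting density of normalized distance to a receiver, with lengths $\sigma$ (per-coordinate standard deviation) and $\nu$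 measured in units of $r_0$. *)

theory Defs
  imports "HOL-Probability.Probability"
begin

text \<open>
  The number of interferers is a random variable \<open>N\<close>. Interferer attributes are given by
  total sequences indexed by \<open>i \<ge> 1\<close>, but only the entries with \<open>i \<le> N \<omega>\<close> are meaningful.
  The index \<open>i = 0\<close> is the reference transmitter, and the receivers are \<open>j = 1\<close> and \<open>j = 2\<close>.
\<close>

text \<open>The \<open>\<sigma>\<close>-algebra of the information carried by the first \<open>N\<close> entries of a sequence
  together with \<open>N\<close>. Entries with \<open>i > N \<omega>\<close> do not contribute.\<close>

definition observed_algebra ::
  "'a measure \<Rightarrow> ('a \<Rightarrow> nat) \<Rightarrow> ('k \<Rightarrow> nat \<Rightarrow> 'a \<Rightarrow> 'b::topological_space) \<Rightarrow> 'k set \<Rightarrow> 'a measure"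
where
  "observed_algebra P N Z K = sigma (space P)
     ({{\<omega> \<in> space P. N \<omega> = m} | m. True} \<union>
      {{\<omega> \<in> space P. i \<le> N \<omega> \<and> Z k i \<omega> \<in> B} | i k B. 1 \<le> i \<and> k \<in> K \<and> B \<in> sets borel})"

definition position_algebra ::
  "'a measure \<Rightarrow> ('a \<Rightarrow> nat) \<Rightarrow> (nat \<Rightarrow> 'a \<Rightarrow> complex) \<Rightarrow> 'a measure"
where
  "position_algebra P N X = observed_algebra P N (\<lambda>_::unit. X) UNIV"

definition distance_algebra ::
  "'a measure \<Rightarrow> ('a \<Rightarrow> nat) \<Rightarrow> (nat \<Rightarrow> nat \<Rightarrow> 'a \<Rightarrow> real) \<Rightarrow> 'a measure"
where
  "distance_algebra P N r = observed_algebra P N (\<lambda>j i. r i j) {1, 2}"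

datatype source = Config | Fading nat nat | Access nat

locale interference_network = prob_space P for P :: "'a measure" +
  fixes r0 \<theta> \<alpha> \<beta> SNR :: real
    and pr :: "nat \<Rightarrow> real"
    and N :: "'a \<Rightarrow> nat"
    and X :: "nat \<Rightarrow> 'a \<Rightarrow> complex"
    and Y :: "nat \<Rightarrow> complex"
    and r :: "nat \<Rightarrow> nat \<Rightarrow> 'a \<Rightarrow> real"
    and g :: "nat \<Rightarrow> nat \<Rightarrow> 'a \<Rightarrow> real"
    and act :: "nat \<Rightarrow> 'a \<Rightarrow> bool"
  assumes r0_pos: "r0 > 0" and alpha_pos: "\<alpha> > 0" and beta_pos: "\<beta> > 0" and SNR_pos: "SNR > 0"
    and transmitter: "X 0 = (\<lambda>_. 0)"
    and receiver_1: "Y 1 = of_real r0"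
    and receiver_2: "Y 2 = of_real r0 * exp (\<i> * of_real \<theta>)"
    and distance: "\<And>i j \<omega>. r i j \<omega> = cmod (X i \<omega> - Y j) / r0"
    and access_prob: "\<And>i. i \<ge> 1 \<Longrightarrow> pr i \<in> {0..1}"
    and number_rv: "random_variable (count_space UNIV) N"
    and position_rv: "\<And>i. i \<ge> 1 \<Longrightarrow> random_variable borel (X i)"
    and fading: "\<And>i j. j \<in> {1, 2} \<Longrightarrow> distributed P lborel (g i j) (exponential_density 1)"
    and access_rv: "\<And>i. i \<ge> 1 \<Longrightarrow> random_variable (count_space UNIV) (act i)"
    and access_distr: "\<And>i. i \<ge> 1 \<Longrightarrow>
      distr P (count_space UNIV) (act i) = measure_pmf (bernoulli_pmf (pr i))"
    and independent: "indep_sets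
      (\<lambda>s. case s of
          Config \<Rightarrow> sets (position_algebra P N X)
        | Fading i j \<Rightarrow> {g i j -` A \<inter> space P | A. A \<in> sets borel}
        | Access i \<Rightarrow> {act i -` A \<inter> space P | A. A \<in> sets (count_space UNIV)})
      ({Config} \<union> {Fading i j | i j. j \<in> {1, 2}} \<union> {Access i | i. i \<ge> 1})"

text \<open>The useful signal carries no path-loss factor since the normalized distance from
  the transmitter to either receiver is \<open>r 0 j = 1\<close>.\<close>

definition sinr ::
  "real \<Rightarrow> real \<Rightarrow> ('a \<Rightarrow> nat) \<Rightarrow> (nat \<Rightarrow> nat \<Rightarrow> 'a \<Rightarrow> real) \<Rightarrow> (nat \<Rightarrow> nat \<Rightarrow> 'a \<Rightarrow> real) \<Rightarrow>
   (nat \<Rightarrow> 'a \<Rightarrow> bool) \<Rightarrow> nat \<Rightarrow> 'a \<Rightarrow> real"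
where
  "sinr \<alpha> SNR N r g act j \<omega> =
     g 0 j \<omega> / (inverse SNR + (\<Sum>i=1..N \<omega>. of_bool (act i \<omega>) * g i j \<omega> * r i j \<omega> powr (-\<alpha>)))"

text \<open>The conditional probability of outage at receiver \<open>j\<close>, given the number of interferers
  and all their normalized distances to both receivers, as a random variable.\<close>

definition outage_prob ::
  "'a measure \<Rightarrow> real \<Rightarrow> real \<Rightarrow> real \<Rightarrow> ('a \<Rightarrow> nat) \<Rightarrow> (nat \<Rightarrow> nat \<Rightarrow> 'a \<Rightarrow> real) \<Rightarrow>
   (nat \<Rightarrow> nat \<Rightarrow> 'a \<Rightarrow> real) \<Rightarrow> (nat \<Rightarrow> 'a \<Rightarrow> bool) \<Rightarrow> nat \<Rightarrow> 'a \<Rightarrow> real"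
where
  "outage_prob P \<alpha> \<beta> SNR N r g act j =
     real_cond_exp P (distance_algebra P N r)
       (indicator {\<omega> \<in> space P. sinr \<alpha> SNR N r g act j \<omega> \<le> \<beta>})"

definition bessel_I0 :: "real \<Rightarrow> real" where
  "bessel_I0 x = (\<Sum>k. (x / 2) ^ (2 * k) / (fact k)\<^sup>2)"

definition dist_density :: "real \<Rightarrow> real \<Rightarrow> real \<Rightarrow> real" where
  "dist_density \<sigma> \<nu> x =
     (if x \<ge> 0 then x / \<sigma>\<^sup>2 * exp (- (x\<^sup>2 + \<nu>\<^sup>2) / (2 * \<sigma>\<^sup>2)) * bessel_I0 (x * \<nu> / \<sigma>\<^sup>2) else 0)"

definition cluster_Q :: "real \<Rightarrow> real \<Rightarrow> real \<Rightarrow> real \<Rightarrow> real \<Rightarrow> real" where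
  "cluster_Q \<alpha> \<beta> p \<nu> \<sigma> =
     (LBINT x:{0..}. dist_density \<sigma> \<nu> x * (1 - p + p * x powr \<alpha> / (\<beta> + x powr \<alpha>))\<^sup>2)"

definition cluster_V :: "real \<Rightarrow> real \<Rightarrow> real \<Rightarrow> real \<Rightarrow> real" where
  "cluster_V \<alpha> \<beta> \<nu> \<sigma> =
     (LBINT x:{0..}. x powr \<alpha> / (\<beta> + x powr \<alpha>) * dist_density \<sigma> \<nu> x)"

definition cluster_C :: "real \<Rightarrow> real \<Rightarrow> real \<Rightarrow> real \<Rightarrow> real" where
  "cluster_C \<alpha> \<beta> \<nu> \<sigma> =
     (LBINT x:{0..}. x powr (2 * \<alpha>) / (\<beta> + x powr \<alpha>)\<^sup>2 * dist_density \<sigma> \<nu> x)"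

end

theory Submission
  imports Defs
begin

text \<open>
  Given the interferers, the fading and access variables are independent of the observed
  distances, so the conditional outage probability is obtained by freezing the distances.
  For fixed distances, \<open>- ln\<close> of the interference factor is an independent random threshold
  for the exponential \<open>g 0 j\<close>, and the Laplace transform of the exponential distribution turns
  each interferer into one factor of a product; hence \<open>\<epsilon> = 1 - c * T\<close> almost surely, with
  \<open>c = exp (- \<beta> / SNR)\<close> and \<open>T\<close> a product over the interferers. The identity
  \<open>(1 - c * T)\<^sup>2 = 2 * (1 - c * T) - 1 + c\<^sup>2 * T\<^sup>2\<close> leaves the second moment of \<open>T\<close>. Given
  \<open>N = m\<close> it is the \<open>m\<close>-th power of \<open>cluster_Q\<close> by independence, and averaging this over the
  Poisson number gives the exponential.
\<close>

section \<open>Independence and freezing in conditional expectations\<close>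

text \<open>Independence makes the joint law of \<open>X\<close> and \<open>Y\<close> the product of
  their laws, and Fubini's theorem then applies. Independence is put in terms of preimage families
  because \<open>indep_var\<close> would force both variables into one value type.\<close>

lemma (in prob_space) indep_set_integral:
  fixes f :: "'b \<times> 'c \<Rightarrow> real"
  assumes X [measurable]: "X \<in> measurable M S" and Y [measurable]: "Y \<in> measurable M T"
    and indep: "indep_set {X -` A \<inter> space M | A. A \<in> sets S} {Y -` A \<inter> space M | A. A \<in> sets T}"
    and f [measurable]: "f \<in> borel_measurable (S \<Otimes>\<^sub>M T)"
    and bound: "\<And>z. \<bar>f z\<bar> \<le> B"
  shows "(\<integral>\<omega>. f (X \<omega>, Y \<omega>) \<partial>M) = (\<integral>\<omega>. \<integral>\<omega>'. f (X \<omega>, Y \<omega>') \<partial>M \<partial>M)"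
proof -
  interpret S: prob_space "distr M S X" by (rule prob_space_distr) simp
  interpret T: prob_space "distr M T Y" by (rule prob_space_distr) simp
  interpret ST: pair_prob_space "distr M S X" "distr M T Y" ..
  have prod: "distr M S X \<Otimes>\<^sub>M distr M T Y = distr M (S \<Otimes>\<^sub>M T) (\<lambda>\<omega>. (X \<omega>, Y \<omega>))"
  proof (rule pair_measure_eqI)
    fix A B assume "A \<in> sets (distr M S X)" "B \<in> sets (distr M T Y)"
    then have [measurable]: "A \<in> sets S" "B \<in> sets T" by simp_all
    have "prob ((X -` A \<inter> space M) \<inter> (Y -` B \<inter> space M)) =
        prob (X -` A \<inter> space M) * prob (Y -` B \<inter> space M)"
      by (intro indep_setD[OF indep]) auto
    moreover have "(X -` A \<inter> space M) \<inter> (Y -` B \<inter> space M) =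
        (\<lambda>\<omega>. (X \<omega>, Y \<omega>)) -` (A \<times> B) \<inter> space M" by auto
    ultimately show "emeasure (distr M S X) A * emeasure (distr M T Y) B =
        emeasure (distr M (S \<Otimes>\<^sub>M T) (\<lambda>\<omega>. (X \<omega>, Y \<omega>))) (A \<times> B)"
      by (simp add: emeasure_distr emeasure_eq_measure ennreal_mult)
  qed (simp_all add: S.sigma_finite_measure_axioms T.sigma_finite_measure_axioms cong: sets_pair_measure_cong)
  have "integrable (distr M S X \<Otimes>\<^sub>M distr M T Y) f"
    by (rule ST.integrable_const_bound[where B=B]) (use bound in auto)
  then have "(\<integral>x. (\<integral>y. f (x, y) \<partial>distr M T Y) \<partial>distr M S X) =
      (\<integral>z. f z \<partial>(distr M S X \<Otimes>\<^sub>M distr M T Y))"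
    by (rule ST.integral_fst')
  also have "\<dots> = (\<integral>\<omega>. f (X \<omega>, Y \<omega>) \<partial>M)"
    by (simp add: prod integral_distr)
  finally have eq: "(\<integral>\<omega>. f (X \<omega>, Y \<omega>) \<partial>M) =
      (\<integral>x. (\<integral>y. f (x, y) \<partial>distr M T Y) \<partial>distr M S X)" ..
  also have "\<dots> = (\<integral>\<omega>. (\<integral>y. f (X \<omega>, y) \<partial>distr M T Y) \<partial>M)"
    by (intro integral_distr T.borel_measurable_lebesgue_integral) simp_all
  also have "\<dots> = (\<integral>\<omega>. \<integral>\<omega>'. f (X \<omega>, Y \<omega>') \<partial>M \<partial>M)"
    by (intro Bochner_Integration.integral_cong refl integral_distr)
      (auto dest: measurable_space[of X M S])
  finally show ?thesis .
qed

text \<open>For a test set \<open>A\<close> in \<open>F\<close> the indicator is a function of the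
  first argument and can be absorbed into the integrand. The double-integral formula, applied to the
  identity as a variable with values in \<open>F\<close> and to \<open>Y\<close>, then gives the
  characteristic property of conditional expectation.\<close>

lemma (in prob_space) real_cond_exp_freezing:
  fixes f :: "'a \<times> 'c \<Rightarrow> real"
  assumes sub: "subalgebra M F" and Y [measurable]: "Y \<in> measurable M T"
    and indep: "indep_set (sets F) {Y -` A \<inter> space M | A. A \<in> sets T}"
    and f [measurable]: "f \<in> borel_measurable (F \<Otimes>\<^sub>M T)"
    and bound: "\<And>z. \<bar>f z\<bar> \<le> B"
  shows "AE \<omega> in M. real_cond_exp M F (\<lambda>\<omega>. f (\<omega>, Y \<omega>)) \<omega> = (\<integral>\<omega>'. f (\<omega>, Y \<omega>') \<partial>M)"
proof -
  interpret finite_measure_subalgebra M F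
    by unfold_locales (rule sub)
  have space: "space F = space M" using sub by (simp add: subalgebra_def)
  have id [measurable]: "(\<lambda>\<omega>. \<omega>) \<in> measurable M F"
    using measurable_from_subalg[OF sub measurable_ident] by (simp add: id_def)
  have "{(\<lambda>\<omega>. \<omega>) -` A \<inter> space M | A. A \<in> sets F} \<subseteq> sets F"
    by (auto simp flip: space)
  then have indep': "indep_set {(\<lambda>\<omega>. \<omega>) -` A \<inter> space M | A. A \<in> sets F}
      {Y -` A \<inter> space M | A. A \<in> sets T}"
    using indep unfolding indep_sets2_eq by blast
  interpret T: prob_space "distr M T Y" by (rule prob_space_distr) simp
  have "(\<lambda>\<omega>. \<integral>y. f (\<omega>, y) \<partial>distr M T Y) \<in> borel_measurable F"
    by (intro T.borel_measurable_lebesgue_integral) simp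
  moreover have "(\<integral>y. f (\<omega>, y) \<partial>distr M T Y) = (\<integral>\<omega>'. f (\<omega>, Y \<omega>') \<partial>M)" if "\<omega> \<in> space F" for \<omega>
    using that by (intro integral_distr) auto
  ultimately have meas [measurable]: "(\<lambda>\<omega>. \<integral>\<omega>'. f (\<omega>, Y \<omega>') \<partial>M) \<in> borel_measurable F"
    by (subst measurable_cong[OF sym]) auto
  have bound': "\<bar>\<integral>\<omega>'. f (\<omega>, Y \<omega>') \<partial>M\<bar> \<le> B" if "\<omega> \<in> space F" for \<omega>
  proof -
    have "integrable M (\<lambda>\<omega>'. f (\<omega>, Y \<omega>'))"
      by (rule integrable_const_bound[where B=B]) (use bound that in auto)
    then have "(\<integral>\<omega>'. f (\<omega>, Y \<omega>') \<partial>M) \<le> B \<and> -B \<le> (\<integral>\<omega>'. f (\<omega>, Y \<omega>') \<partial>M)"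
      using bound by (auto intro!: integral_le_const integral_ge_const AE_I2 simp: abs_le_iff minus_le_iff)
    then show ?thesis by auto
  qed
  show ?thesis
  proof (rule real_cond_exp_charact)
    show "integrable M (\<lambda>\<omega>. f (\<omega>, Y \<omega>))"
      by (rule integrable_const_bound[where B=B]) (use bound in auto)
    show "integrable M (\<lambda>\<omega>. \<integral>\<omega>'. f (\<omega>, Y \<omega>') \<partial>M)"
      using measurable_from_subalg[OF sub meas] bound' space
      by (intro integrable_const_bound[where B=B]) auto
    fix A assume A [measurable]: "A \<in> sets F"
    have "\<bar>indicator A (fst z) * f z\<bar> \<le> B" for z
      using bound[of z] by (auto simp: indicator_def)
    then have "(\<integral>\<omega>. indicator A (fst (\<omega>, Y \<omega>)) * f (\<omega>, Y \<omega>) \<partial>M) =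
        (\<integral>\<omega>. \<integral>\<omega>'. indicator A (fst (\<omega>, Y \<omega>')) * f (\<omega>, Y \<omega>') \<partial>M \<partial>M)"
      by (intro indep_set_integral[OF id Y indep', where B=B]) auto
    then show "(\<integral>\<omega>\<in>A. f (\<omega>, Y \<omega>) \<partial>M) = (\<integral>\<omega>\<in>A. (\<integral>\<omega>'. f (\<omega>, Y \<omega>') \<partial>M) \<partial>M)"
      by (simp add: set_lebesgue_integral_def)
  qed (rule meas)
qed

section \<open>Expectations of exponential and Bernoulli variables\<close>

text \<open>On the half-line \<open>exp (- x) * exp (- s * x)\<close> is \<open>1 / (1 + s)\<close>
  times the exponential density of rate \<open>1 + s\<close>, which has total mass 1.\<close>

lemma (in prob_space) exponential_laplace:
  assumes X: "distributed M lborel X (exponential_density 1)" and s: "s \<ge> 0"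
  shows "expectation (\<lambda>\<omega>. exp (- s * X \<omega>)) = 1 / (1 + s)"
proof -
  have "exponential_density 1 x * exp (- s * x) = exponential_density (1 + s) x / (1 + s)" for x
  proof -
    have "exp (- x) * exp (- s * x) = exp (- x * (1 + s))"
      by (simp add: algebra_simps mult_exp_exp)
    then show ?thesis using s by (simp add: exponential_density_def)
  qed
  then have "expectation (\<lambda>\<omega>. exp (- s * X \<omega>)) = (\<integral>x. exponential_density (1 + s) x \<partial>lborel) / (1 + s)"
    using distributed_integral[OF X, of "\<lambda>x. exp (- s * x)"] by (simp add: exponential_density_nonneg)
  moreover interpret E: prob_space "density lborel (exponential_density (1 + s))"
    using s by (intro prob_space_exponential_density) simp
  have "(\<integral>x. exponential_density (1 + s) x \<partial>lborel) = 1"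
    using E.prob_space s integral_density[of "\<lambda>_. 1 :: real" lborel "exponential_density (1 + s)"]
    by (simp add: exponential_density_nonneg)
  ultimately show ?thesis by simp
qed

lemma (in prob_space) bernoulli_expectation:
  fixes h :: "bool \<Rightarrow> real"
  assumes A [measurable]: "random_variable (count_space UNIV) A"
    and distr: "distr M (count_space UNIV) A = measure_pmf (bernoulli_pmf q)" and q: "q \<in> {0..1}"
  shows "expectation (\<lambda>\<omega>. h (A \<omega>)) = q * h True + (1 - q) * h False"
  using integral_distr[OF A, of h] q by (simp add: distr mult.commute)

section \<open>Fading and access variables, and outage for fixed gains\<close>

text \<open>All random inputs of the SINR at receiver \<open>j\<close> other than the configuration;
  the fading with index 0 is that of the useful signal.\<close>

definition link_sources :: "nat \<Rightarrow> source set" where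
  "link_sources j = {Fading i j | i. True} \<union> {Access i | i. i \<ge> 1}"

context interference_network
begin

text \<open>Access variables become 0/1-valued reals, so that one real-valued family covers all sources.\<close>

definition link_var :: "source \<Rightarrow> 'a \<Rightarrow> real" where
  "link_var s \<omega> = (case s of Config \<Rightarrow> 0 | Fading i k \<Rightarrow> g i k \<omega> | Access i \<Rightarrow> of_bool (act i \<omega>))"

lemma link_var_simps [simp]:
  "link_var (Fading i k) = g i k" "link_var (Access i) = (\<lambda>\<omega>. of_bool (act i \<omega>))"
  by (simp_all add: link_var_def fun_eq_iff)

lemma fading_measurable: "k \<in> {1, 2} \<Longrightarrow> random_variable borel (g i k)"
  using distributed_measurable[OF fading[of k i]] by (simp add: measurable_lborel1)

lemma link_var_measurable:
  assumes "j \<in> {1, 2}" "s \<in> link_sources j"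
  shows "random_variable borel (link_var s)"
proof (cases s)
  case (Access i)
  then have "i \<ge> 1" using assms by (auto simp: link_sources_def)
  then show ?thesis
    unfolding Access link_var_simps by (intro measurable_compose[OF access_rv]) auto
next
  case (Fading i k)
  then have "k = j" using assms by (auto simp: link_sources_def)
  then show ?thesis using Fading fading_measurable[OF assms(1)] by simp
next
  case Config
  then have False using assms(2) by (simp add: link_sources_def)
  then show ?thesis ..
qed

text \<open>Carries the independence postulated for the raw sources over to the real-valued
  \<open>link_var\<close>: an event about \<open>of_bool (act i \<omega>)\<close> is an event about
  \<open>act i \<omega>\<close>.\<close>

lemma link_var_vimage_subset:
  assumes "s \<in> link_sources j"
  shows "{link_var s -` A \<inter> space P | A. A \<in> sets borel} \<subseteq>
    (case s of Config \<Rightarrow> sets (position_algebra P N X)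
      | Fading i j \<Rightarrow> {g i j -` A \<inter> space P | A. A \<in> sets borel}
      | Access i \<Rightarrow> {act i -` A \<inter> space P | A. A \<in> sets (count_space UNIV)})"
proof (cases s)
  case (Access i)
  have "link_var s -` A = act i -` {b. of_bool b \<in> A}" for A
    by (auto simp: Access)
  then have "link_var s -` A \<inter> space P \<in> {act i -` B \<inter> space P | B. B \<in> sets (count_space UNIV)}" for A
    by (intro CollectI exI[of _ "{b. of_bool b \<in> A}"] conjI) simp_all
  then show ?thesis unfolding Access source.case by blast
next
  case (Fading i k)
  show ?thesis unfolding Fading source.case link_var_simps ..
next
  case Config
  then have False using assms by (simp add: link_sources_def)
  then show ?thesis ..
qed

lemma link_sources_subset:
  "j \<in> {1, 2} \<Longrightarrow> link_sources j \<subseteq>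
    {Config} \<union> {Fading i j | i j. j \<in> {1, 2}} \<union> {Access i | i. i \<ge> 1}"
  by (auto simp: link_sources_def)

lemma indep_vars_link:
  assumes j: "j \<in> {1, 2}"
  shows "indep_vars (\<lambda>_. borel) link_var (link_sources j)"
  unfolding indep_vars_def2
proof (intro conjI ballI)
  show "indep_sets (\<lambda>s. {link_var s -` A \<inter> space P | A. A \<in> sets borel}) (link_sources j)"
    by (rule indep_sets_mono[OF independent link_sources_subset[OF j] link_var_vimage_subset])
qed (rule link_var_measurable[OF j])

text \<open>The \<open>c i\<close> stand for frozen path gains. Almost surely the denominator is
  positive, so outage means \<open>g 0 j \<omega> \<le> \<beta> / SNR - ln (W \<omega>)\<close>,
  where \<open>W\<close> is the exponential of \<open>- \<beta>\<close> times the interference.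
  Integrating out \<open>g 0 j\<close> leaves \<open>expectation W\<close>, which factors over the
  interferers.\<close>

lemma prob_outage_fixed_gains:
  assumes j: "j \<in> {1, 2}" and c: "\<And>i. c i \<ge> 0"
  shows "prob {\<omega> \<in> space P.
      g 0 j \<omega> / (inverse SNR + (\<Sum>i=1..m. of_bool (act i \<omega>) * g i j \<omega> * c i)) \<le> \<beta>} =
    1 - exp (- (\<beta> / SNR)) * (\<Prod>i=1..m. 1 - pr i + pr i / (1 + \<beta> * c i))"
proof -
  note [measurable] = fading_measurable[OF j] access_rv
  \<comment> \<open>Disjoint blocks of sources: block 0 is the useful signal, block \<open>i\<close>
    is interferer \<open>i\<close>. Each \<open>H i\<close> reads only its own block, through
    \<open>h i\<close>, so the \<open>H i\<close> are independent.\<close>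
  define K where "K i = (if i = 0 then {Fading 0 j} else {Fading i j, Access i})" for i
  define H where "H i \<omega> = (if i = 0 then g 0 j \<omega> else exp (- \<beta> * (of_bool (act i \<omega>) * g i j \<omega> * c i)))" for i \<omega>
  define h where "h i v = (if i = 0 then v (Fading 0 j) else
      exp (- \<beta> * (v (Access i) * v (Fading i j) * c i)))" for i and v :: "source \<Rightarrow> real"
  define W where "W \<omega> = (\<Prod>i=1..m. H i \<omega>)" for \<omega>
  have "indep_vars (\<lambda>i. PiM (K i) (\<lambda>_. borel)) (\<lambda>i \<omega>. restrict (\<lambda>s. link_var s \<omega>) (K i)) {0..m}"
    by (rule indep_vars_restrict[OF indep_vars_link[OF j]])
      (auto simp: K_def link_sources_def disjoint_family_on_def)
  then have "indep_vars (\<lambda>_. borel) (\<lambda>i \<omega>. h i (restrict (\<lambda>s. link_var s \<omega>) (K i))) {0..m}"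
    by (rule indep_vars_compose2) (auto simp: h_def K_def)
  also have "(\<lambda>i \<omega>. h i (restrict (\<lambda>s. link_var s \<omega>) (K i))) = H"
    by (auto simp: fun_eq_iff h_def H_def K_def)
  finally have H: "indep_vars (\<lambda>_. borel) H (insert 0 {1..m})"
    by (simp add: atLeastAtMost_insertL)
  have "indep_var borel (H 0) borel W"
    unfolding W_def by (rule indep_vars_prod[OF _ _ H]) auto
  moreover have H0: "H 0 = g 0 j" by (simp add: H_def fun_eq_iff)
  ultimately have ind: "indep_var borel (g 0 j) borel W" by simp
  have [measurable]: "W \<in> borel_measurable P"
    unfolding W_def H_def by measurable

  \<comment> \<open>Positive fading yields \<open>H i \<omega> \<le> 1\<close> and a positive SINR
    denominator; the exponential law gives it only almost surely.\<close>
  have g_pos: "AE \<omega> in P. \<forall>i. g i j \<omega> > 0"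
    unfolding AE_all_countable
  proof
    fix i
    have "prob {\<omega> \<in> space P. g i j \<omega> \<le> 0} = 0"
      using exponential_distributedD_le[OF fading[OF j], of 0 i] by simp
    then have "AE \<omega> in P. \<omega> \<notin> {\<omega> \<in> space P. g i j \<omega> \<le> 0}"
      by (subst (asm) prob_eq_0) auto
    then show "AE \<omega> in P. g i j \<omega> > 0"
      using AE_space by eventually_elim auto
  qed
  have H_pos: "H i \<omega> > 0" if "i \<ge> 1" for i \<omega>
    using that by (simp add: H_def)
  have H_le: "AE \<omega> in P. \<forall>i\<ge>1. H i \<omega> \<le> 1"
    using g_pos by eventually_elim (use c beta_pos in \<open>auto simp: H_def less_imp_le\<close>)
  have W_pos: "W \<omega> > 0" for \<omega>
    unfolding W_def using H_pos by (auto intro!: prod_pos)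
  have W_le: "AE \<omega> in P. W \<omega> \<le> 1"
    using H_le unfolding W_def
    by eventually_elim (use H_pos in \<open>auto intro!: prod_le_1 simp: less_imp_le\<close>)
  have [measurable]: "H i \<in> borel_measurable P" if "i \<ge> 1" for i
    using that unfolding H_def by measurable
  have int_H: "integrable P (H i)" if "i \<ge> 1" for i
    by (rule integrable_const_bound[where B=1])
      (use H_le H_pos that in \<open>auto elim!: eventually_mono simp: less_imp_le\<close>)

  have EH: "expectation (H i) = 1 - pr i + pr i / (1 + \<beta> * c i)" if i: "i \<ge> 1" for i
  proof -
    note [measurable] = access_rv[OF i]
    define E where "E \<omega> = exp (- (\<beta> * c i) * g i j \<omega>)" for \<omega>
    have E_meas [measurable]: "E \<in> borel_measurable P" unfolding E_def by measurable
    have int_E: "integrable P E"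
      by (rule integrable_const_bound[where B=1])
        (use g_pos beta_pos c[of i] in \<open>auto elim!: eventually_mono simp: E_def less_imp_le\<close>)
    have EE: "expectation E = 1 / (1 + \<beta> * c i)"
      unfolding E_def using beta_pos c[of i] by (intro exponential_laplace fading j) auto
    have "indep_vars (\<lambda>_. borel) link_var (insert (Access i) {Fading i j})"
      by (rule indep_vars_subset[OF indep_vars_link[OF j]]) (use i in \<open>auto simp: link_sources_def\<close>)
    \<comment> \<open>The product over a singleton extracts the independence of a pair from that of
      the family.\<close>
    then have "indep_var borel (link_var (Access i)) borel (\<lambda>\<omega>. \<Prod>s\<in>{Fading i j}. link_var s \<omega>)"
      by (intro indep_vars_prod) auto
    then have "indep_var borel (\<lambda>\<omega>. of_bool (act i \<omega>)) borel (g i j)"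
      by simp
    then have "indep_var borel ((\<lambda>x. x) \<circ> (\<lambda>\<omega>. of_bool (act i \<omega>)))
        borel ((\<lambda>x. exp (- (\<beta> * c i) * x) - 1) \<circ> g i j)"
      by (rule indep_var_compose) auto
    then have ind: "indep_var borel (\<lambda>\<omega>. of_bool (act i \<omega>) :: real) borel (\<lambda>\<omega>. E \<omega> - 1)"
      by (simp add: comp_def E_def)
    have int_A: "integrable P (\<lambda>\<omega>. of_bool (act i \<omega>) :: real)"
      by (rule integrable_const_bound[where B=1]) auto
    have EA: "expectation (\<lambda>\<omega>. of_bool (act i \<omega>) :: real) = pr i"
      using bernoulli_expectation[OF access_rv[OF i] access_distr[OF i] access_prob[OF i], of of_bool]
      by simp
    have int_E1: "integrable P (\<lambda>\<omega>. E \<omega> - 1)" using int_E by simp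
    \<comment> \<open>Activity is 0 or 1, so \<open>H i\<close> is affine in it and its expectation
      follows from the product rule for two independent factors.\<close>
    have "H i = (\<lambda>\<omega>. 1 + of_bool (act i \<omega>) * (E \<omega> - 1))"
      using i by (auto simp: fun_eq_iff H_def E_def)
    then have "expectation (H i) = 1 + expectation (\<lambda>\<omega>. of_bool (act i \<omega>) * (E \<omega> - 1))"
      using indep_var_integrable[OF ind int_A int_E1] by (simp add: prob_space)
    also have "\<dots> = 1 + pr i * (1 / (1 + \<beta> * c i) - 1)"
      using indep_var_lebesgue_integral[OF ind int_A int_E1] int_E EE EA by (simp add: prob_space)
    finally show ?thesis by (simp add: algebra_simps)
  qed
  have EW: "expectation W = (\<Prod>i=1..m. 1 - pr i + pr i / (1 + \<beta> * c i))"
  proof -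
    have "expectation W = (\<Prod>i=1..m. expectation (H i))"
      unfolding W_def by (rule indep_vars_lebesgue_integral)
        (use int_H in \<open>auto intro!: indep_vars_subset[OF H]\<close>)
    then show ?thesis by (simp add: EH)
  qed
  have int_W: "integrable P W"
    by (rule integrable_const_bound[where B=1])
      (use W_le W_pos in \<open>auto elim!: eventually_mono simp: less_imp_le\<close>)

  define f where "f z = (indicator {z. snd z \<le> \<beta> / SNR - ln (fst z)} z :: real)" for z
  have f_meas [measurable]: "f \<in> borel_measurable (borel \<Otimes>\<^sub>M borel)"
    unfolding f_def by measurable
  have "indep_set {W -` A \<inter> space P | A. A \<in> sets borel} {g 0 j -` A \<inter> space P | A. A \<in> sets borel}"
  proof (rule indep_setI)
    fix a b assume "a \<in> {W -` A \<inter> space P | A. A \<in> sets borel}"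
      "b \<in> {g 0 j -` A \<inter> space P | A. A \<in> sets borel}"
    then obtain A B where "A \<in> sets borel" "B \<in> sets borel"
      and ab: "a = W -` A \<inter> space P" "b = g 0 j -` B \<inter> space P" by blast
    then have "prob ((\<lambda>\<omega>. (g 0 j \<omega>, W \<omega>)) -` (B \<times> A) \<inter> space P) = prob b * prob a"
      using indep_varD[OF ind] by simp
    moreover have "(\<lambda>\<omega>. (g 0 j \<omega>, W \<omega>)) -` (B \<times> A) \<inter> space P = a \<inter> b"
      by (auto simp: ab)
    ultimately show "prob (a \<inter> b) = prob a * prob b" by simp
  qed (auto intro!: measurable_sets)
  then have "expectation (\<lambda>\<omega>. f (W \<omega>, g 0 j \<omega>)) = expectation (\<lambda>\<omega>. expectation (\<lambda>\<omega>'. f (W \<omega>, g 0 j \<omega>')))"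
    by (intro indep_set_integral[where B=1]) (auto simp: f_def)
  also have "\<dots> = expectation (\<lambda>\<omega>. 1 - exp (- (\<beta> / SNR)) * W \<omega>)"
  proof (rule integral_cong_AE)
    show "AE \<omega> in P. expectation (\<lambda>\<omega>'. f (W \<omega>, g 0 j \<omega>')) = 1 - exp (- (\<beta> / SNR)) * W \<omega>"
      using W_le
    proof eventually_elim
      case (elim \<omega>)
      \<comment> \<open>Since \<open>W \<omega> \<le> 1\<close>, this threshold is nonnegative, as
        the closed form of the exponential distribution function requires.\<close>
      define t where "t = \<beta> / SNR - ln (W \<omega>)"
      have "ln (W \<omega>) \<le> 0" "\<beta> / SNR > 0"
        using elim W_pos[of \<omega>] beta_pos SNR_pos by simp_all
      then have "t \<ge> 0" by (simp add: t_def)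
      have "expectation (\<lambda>\<omega>'. f (W \<omega>, g 0 j \<omega>')) =
          expectation (indicator {\<omega>' \<in> space P. g 0 j \<omega>' \<le> t})"
        by (intro Bochner_Integration.integral_cong) (auto simp: f_def t_def indicator_def)
      also have "\<dots> = prob {\<omega>' \<in> space P. g 0 j \<omega>' \<le> t}"
        by simp
      also have "\<dots> = 1 - exp (- t)"
        using exponential_distributedD_le[OF fading[OF j], of t 0] \<open>t \<ge> 0\<close> by simp
      also have "exp (- t) = exp (- (\<beta> / SNR)) * W \<omega>"
        using W_pos[of \<omega>] by (simp add: t_def exp_diff exp_minus field_simps)
      finally show ?case .
    qed
  qed measurable
  also have "\<dots> = 1 - exp (- (\<beta> / SNR)) * (\<Prod>i=1..m. 1 - pr i + pr i / (1 + \<beta> * c i))"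
    using int_W by (simp add: prob_space EW)
  also have "expectation (\<lambda>\<omega>. f (W \<omega>, g 0 j \<omega>)) = expectation (indicator {\<omega> \<in> space P.
      g 0 j \<omega> / (inverse SNR + (\<Sum>i=1..m. of_bool (act i \<omega>) * g i j \<omega> * c i)) \<le> \<beta>})"
  proof (rule integral_cong_AE)
    show "AE \<omega> in P. f (W \<omega>, g 0 j \<omega>) = indicator {\<omega> \<in> space P.
      g 0 j \<omega> / (inverse SNR + (\<Sum>i=1..m. of_bool (act i \<omega>) * g i j \<omega> * c i)) \<le> \<beta>} \<omega>"
      using g_pos AE_space
    proof eventually_elim
      case (elim \<omega>)
      define S where "S = (\<Sum>i=1..m. of_bool (act i \<omega>) * g i j \<omega> * c i)"
      have "S \<ge> 0"
        unfolding S_def using elim c by (intro sum_nonneg) (auto simp: less_imp_le)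
      then have "inverse SNR + S > 0" using SNR_pos by (simp add: add_pos_nonneg)
      moreover have "ln (W \<omega>) = - \<beta> * S"
        unfolding W_def S_def sum_distrib_left by (subst ln_prod) (auto simp: H_def)
      ultimately have "g 0 j \<omega> / (inverse SNR + S) \<le> \<beta> \<longleftrightarrow> g 0 j \<omega> \<le> \<beta> / SNR - ln (W \<omega>)"
        by (simp add: pos_divide_le_eq) (simp add: algebra_simps divide_inverse)
      then show ?case
        using elim unfolding f_def indicator_def mem_Collect_eq S_def[symmetric]
        by simp
    qed
  qed measurable
  finally show ?thesis by simp
qed

end

section \<open>Measurability with respect to the observed entries\<close>

lemma space_observed_algebra [simp]: "space (observed_algebra P N Z K) = space P"
  unfolding observed_algebra_def by (rule space_measure_of) auto

lemma sets_observed_algebra: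
  "sets (observed_algebra P N Z K) = sigma_sets (space P)
     ({{\<omega> \<in> space P. N \<omega> = m} | m. True} \<union>
      {{\<omega> \<in> space P. i \<le> N \<omega> \<and> Z k i \<omega> \<in> B} | i k B. 1 \<le> i \<and> k \<in> K \<and> B \<in> sets borel})"
  unfolding observed_algebra_def by (rule sets_measure_of) auto

lemma number_measurable_observed: "N \<in> measurable (observed_algebra P N Z K) (count_space UNIV)"
proof -
  have "N -` {m} \<inter> space P \<in> sets (observed_algebra P N Z K)" for m
  proof -
    have "N -` {m} \<inter> space P = {\<omega> \<in> space P. N \<omega> = m}" by auto
    then show ?thesis unfolding sets_observed_algebra by (intro sigma_sets.Basic) auto
  qed
  then show ?thesis by (simp add: measurable_count_space_eq2_countable)
qed

text \<open>The generators speak of \<open>Z k i\<close> only where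
  \<open>i \<le> N \<omega>\<close>. Replacing it by a constant elsewhere gives an observable
  variable, because the event \<open>i \<le> N \<omega>\<close> is itself observed.\<close>

lemma observed_measurable:
  fixes Z :: "'k \<Rightarrow> nat \<Rightarrow> 'a \<Rightarrow> 'b::topological_space"
  assumes "i \<ge> 1" "k \<in> K"
  shows "(\<lambda>\<omega>. if i \<le> N \<omega> then Z k i \<omega> else c) \<in> borel_measurable (observed_algebra P N Z K)"
proof (rule measurableI)
  note [measurable] = number_measurable_observed
  fix B :: "'b set" assume B: "B \<in> sets borel"
  let ?O = "observed_algebra P N Z K"
  have "{\<omega> \<in> space P. i \<le> N \<omega> \<and> Z k i \<omega> \<in> B} \<in> sets ?O"
    unfolding sets_observed_algebra using assms B by (intro sigma_sets.Basic) blast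
  moreover have "{\<omega> \<in> space ?O. \<not> i \<le> N \<omega> \<and> c \<in> B} \<in> sets ?O"
    by measurable
  ultimately have "{\<omega> \<in> space P. i \<le> N \<omega> \<and> Z k i \<omega> \<in> B} \<union> {\<omega> \<in> space P. \<not> i \<le> N \<omega> \<and> c \<in> B} \<in> sets ?O"
    by simp
  also have "{\<omega> \<in> space P. i \<le> N \<omega> \<and> Z k i \<omega> \<in> B} \<union> {\<omega> \<in> space P. \<not> i \<le> N \<omega> \<and> c \<in> B} =
      (\<lambda>\<omega>. if i \<le> N \<omega> then Z k i \<omega> else c) -` B \<inter> space ?O"
    by (auto split: if_splits)
  finally show "(\<lambda>\<omega>. if i \<le> N \<omega> then Z k i \<omega> else c) -` B \<inter> space ?O \<in> sets ?O" .
qed simp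

section \<open>Independence of the distances from fading and access\<close>

context interference_network
begin

text \<open>Part of the meaning of \<open>indep_sets\<close> is that each family consists of
  events.\<close>

lemma sets_position_algebra_subset: "sets (position_algebra P N X) \<subseteq> events"
proof -
  have "\<forall>s\<in>{Config} \<union> {Fading i j | i j. j \<in> {1, 2}} \<union> {Access i | i. i \<ge> 1}. (case s of
          Config \<Rightarrow> sets (position_algebra P N X)
        | Fading i j \<Rightarrow> {g i j -` A \<inter> space P | A. A \<in> sets borel}
        | Access i \<Rightarrow> {act i -` A \<inter> space P | A. A \<in> sets (count_space UNIV)}) \<subseteq> events"
    using independent unfolding indep_sets_def by (rule conjunct1)
  from bspec[OF this, of Config] show ?thesis by simp
qed

text \<open>A distance event is the position event for the preimage under the Borel map
  \<open>x \<mapsto> cmod (x - Y k) / r0\<close>, so each generator on the left lies in the algebra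
  on the right.\<close>

lemma sets_distance_algebra_subset:
  "sets (distance_algebra P N r) \<subseteq> sets (position_algebra P N X)"
proof -
  have "{\<omega> \<in> space P. i \<le> N \<omega> \<and> r i k \<omega> \<in> B} \<in> sets (position_algebra P N X)"
    if "1 \<le> i" "B \<in> sets borel" for i k B
  proof -
    have "(\<lambda>x. cmod (x - Y k) / r0) -` B \<inter> space borel \<in> sets borel"
      by (rule measurable_sets[OF _ that(2)]) measurable
    then have "{\<omega> \<in> space P. i \<le> N \<omega> \<and> X i \<omega> \<in> (\<lambda>x. cmod (x - Y k) / r0) -` B} \<in> sets (position_algebra P N X)"
      unfolding position_algebra_def sets_observed_algebra using that(1)
      by (intro sigma_sets.Basic) auto
    then show ?thesis by (simp add: distance)
  qed
  moreover have "{\<omega> \<in> space P. N \<omega> = m} \<in> sets (position_algebra P N X)" for m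
    unfolding position_algebra_def sets_observed_algebra by (intro sigma_sets.Basic) blast
  ultimately have "sigma_sets (space (position_algebra P N X)) ({{\<omega> \<in> space P. N \<omega> = m} | m. True} \<union>
      {{\<omega> \<in> space P. i \<le> N \<omega> \<and> r i k \<omega> \<in> B} | i k B. 1 \<le> i \<and> k \<in> {1, 2} \<and> B \<in> sets borel})
      \<subseteq> sets (position_algebra P N X)"
    by (intro sets.sigma_sets_subset) blast
  then show ?thesis
    by (simp add: distance_algebra_def sets_observed_algebra position_algebra_def)
qed

lemma subalgebra_distance: "subalgebra P (distance_algebra P N r)"
  using sets_distance_algebra_subset sets_position_algebra_subset
  by (simp add: subalgebra_def distance_algebra_def)

text \<open>The sources are grouped into the configuration and the inputs of receiver
  \<open>j\<close>. Disjoint groups of independent, intersection-stable families generate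
  independent \<sigma>-algebras, and independence passes to the smaller families in the statement.
  It is needed for the whole vector jointly, since freezing is applied to that vector.\<close>

lemma indep_set_distance_link:
  assumes j: "j \<in> {1, 2}"
  shows "indep_set (sets (distance_algebra P N r))
    {(\<lambda>\<omega>. restrict (\<lambda>s. link_var s \<omega>) (link_sources j)) -` A \<inter> space P | A.
       A \<in> sets (PiM (link_sources j) (\<lambda>_. borel))}"
proof -
  define E where "E s = (if s = Config then sets (distance_algebra P N r)
    else {link_var s -` A \<inter> space P | A. A \<in> sets borel})" for s
  define I where "I = case_bool {Config} (link_sources j)"
  let ?G = "\<Union>s\<in>link_sources j. {link_var s -` A \<inter> space P | A. A \<in> sets borel}"
  have nConfig: "Config \<notin> link_sources j" by (simp add: link_sources_def)
  have "indep_sets E (\<Union>b\<in>UNIV. I b)"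
  proof (rule indep_sets_mono[OF independent])
    show "(\<Union>b\<in>UNIV. I b) \<subseteq> {Config} \<union> {Fading i j | i j. j \<in> {1, 2}} \<union> {Access i | i. i \<ge> 1}"
      using link_sources_subset[OF j] by (simp add: UNIV_bool I_def)
    fix s assume "s \<in> (\<Union>b\<in>UNIV. I b)"
    then consider "s = Config" | "s \<in> link_sources j" by (auto simp: UNIV_bool I_def)
    then show "E s \<subseteq> (case s of
          Config \<Rightarrow> sets (position_algebra P N X)
        | Fading i j \<Rightarrow> {g i j -` A \<inter> space P | A. A \<in> sets borel}
        | Access i \<Rightarrow> {act i -` A \<inter> space P | A. A \<in> sets (count_space UNIV)})"
    proof cases
      case 1
      then show ?thesis using sets_distance_algebra_subset by (simp add: E_def)
    next
      case 2
      then have "E s = {link_var s -` A \<inter> space P | A. A \<in> sets borel}"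
        using nConfig by (auto simp: E_def)
      then show ?thesis using link_var_vimage_subset[OF 2] by simp
    qed
  qed
  moreover have "Int_stable (E s)" for s
  proof (cases "s = Config")
    case True
    then show ?thesis by (simp add: E_def sets.Int_stable)
  next
    case False
    show ?thesis
    proof (rule Int_stableI)
      fix a b assume "a \<in> E s" "b \<in> E s"
      then obtain A B where "A \<in> sets borel" "B \<in> sets borel"
        "a = link_var s -` A \<inter> space P" "b = link_var s -` B \<inter> space P"
        using False by (auto simp: E_def)
      then have "a \<inter> b = link_var s -` (A \<inter> B) \<inter> space P" "A \<inter> B \<in> sets borel" by auto
      then show "a \<inter> b \<in> E s" unfolding E_def if_not_P[OF False] by blast
    qed
  qed
  moreover have "disjoint_family_on I UNIV"
    using nConfig by (auto simp: disjoint_family_on_def I_def UNIV_bool)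
  ultimately have ind: "indep_sets (\<lambda>b. sigma_sets (space P) (\<Union>s\<in>I b. E s)) UNIV"
    by (intro indep_sets_collect_sigma) auto
  have sub_True: "sets (distance_algebra P N r) \<subseteq> sigma_sets (space P) (\<Union>s\<in>I True. E s)"
    by (auto simp: I_def E_def)
  have sub_False: "{(\<lambda>\<omega>. restrict (\<lambda>s. link_var s \<omega>) (link_sources j)) -` A \<inter> space P | A.
       A \<in> sets (PiM (link_sources j) (\<lambda>_. borel))} \<subseteq> sigma_sets (space P) (\<Union>s\<in>I False. E s)"
  proof -
    have G: "(\<Union>s\<in>I False. E s) = ?G"
      using nConfig by (auto simp: I_def E_def)
    have sets_G: "sets (sigma (space P) ?G) = sigma_sets (space P) ?G"
      by (rule sets_measure_of) auto
    have space_G: "space (sigma (space P) ?G) = space P"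
      by (rule space_measure_of) auto
    \<comment> \<open>Measurability into a product space is checked by coordinates, so every event
      about the vector is generated by coordinate events.\<close>
    have "(\<lambda>\<omega>. restrict (\<lambda>s. link_var s \<omega>) (link_sources j)) \<in>
        measurable (sigma (space P) ?G) (PiM (link_sources j) (\<lambda>_. borel))"
    proof (rule measurable_restrict)
      fix s assume s: "s \<in> link_sources j"
      show "link_var s \<in> borel_measurable (sigma (space P) ?G)"
      proof (rule measurableI)
        fix B :: "real set" assume "B \<in> sets borel"
        then have "link_var s -` B \<inter> space P \<in> ?G" using s by blast
        then show "link_var s -` B \<inter> space (sigma (space P) ?G) \<in> sets (sigma (space P) ?G)"
          unfolding sets_G space_G by (rule sigma_sets.Basic)
      qed simp
    qed
    from measurable_sets[OF this, unfolded space_G sets_G] show ?thesis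
      unfolding G by blast
  qed
  from ind show ?thesis
    unfolding indep_set_def
    by (rule indep_sets_mono_sets) (use sub_True sub_False in \<open>simp split: bool.split\<close>)
qed

section \<open>Product form of the conditional outage probability\<close>

text \<open>Freezing with the distance algebra as \<open>F\<close> and the vector of fading and
  access variables as \<open>Y\<close> reduces the claim to \<open>prob_outage_fixed_gains\<close>.
  For positive \<open>x = r i j \<omega>\<close> the factor
  \<open>1 / (1 + \<beta> * x powr (- \<alpha>))\<close> is
  \<open>x powr \<alpha> / (\<beta> + x powr \<alpha>)\<close>.\<close>

lemma outage_prob_eq:
  assumes j: "j \<in> {1, 2}"
  shows "AE \<omega> in P. outage_prob P \<alpha> \<beta> SNR N r g act j \<omega> =
    1 - exp (- (\<beta> / SNR)) * (\<Prod>i=1..N \<omega>. 1 - pr i + pr i / (1 + \<beta> * r i j \<omega> powr (- \<alpha>)))"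
proof -
  let ?D = "distance_algebra P N r" and ?L = "PiM (link_sources j) (\<lambda>_. borel) :: (source \<Rightarrow> real) measure"
  define V where "V \<omega> = restrict (\<lambda>s. link_var s \<omega>) (link_sources j)" for \<omega>
  \<comment> \<open>Masked by \<open>i \<le> N \<omega>\<close>, since \<open>r i j\<close> itself need not be observable.\<close>
  define G where "G i \<omega> = (if i \<le> N \<omega> then r i j \<omega> else 0) powr (- \<alpha>)" for i \<omega>
  define f where "f z = (indicator {(\<omega>, v). v (Fading 0 j) /
      (inverse SNR + (\<Sum>i=1..N \<omega>. v (Access i) * v (Fading i j) * G i \<omega>)) \<le> \<beta>} z :: real)" for z
  have src: "Fading i j \<in> link_sources j" "i \<ge> 1 \<Longrightarrow> Access i \<in> link_sources j" for i
    by (auto simp: link_sources_def)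
  have V_simps [simp]: "V \<omega> (Fading i j) = g i j \<omega>" "i \<ge> 1 \<Longrightarrow> V \<omega> (Access i) = of_bool (act i \<omega>)" for i \<omega>
    by (auto simp: V_def link_sources_def)
  have V_meas [measurable]: "V \<in> measurable P ?L"
    unfolding V_def by (intro measurable_restrict link_var_measurable[OF j])
  have N_meas [measurable]: "N \<in> measurable ?D (count_space UNIV)"
    unfolding distance_algebra_def by (rule number_measurable_observed)
  have G_meas: "G i \<in> borel_measurable ?D" if "i \<ge> 1" for i
    unfolding G_def distance_algebra_def
    by (intro powr_real_measurable observed_measurable[where Z="\<lambda>k i. r i k"] that j) auto
  have f_meas [measurable]: "f \<in> borel_measurable (?D \<Otimes>\<^sub>M ?L)"
  proof -
    have comp: "(\<lambda>z. snd z s) \<in> borel_measurable (?D \<Otimes>\<^sub>M ?L)" if "s \<in> link_sources j" for s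
      using measurable_compose[OF measurable_snd measurable_component_singleton[OF that, of "\<lambda>_. borel"]] .
    \<comment> \<open>The number of summands is random: joint measurability is shown for each fixed
      \<open>m\<close> first, then \<open>m\<close> is replaced by the countably-valued
      \<open>N\<close>.\<close>
    have "(\<lambda>z. snd z (Fading 0 j) / (inverse SNR +
        (\<Sum>i=1..m. snd z (Access i) * snd z (Fading i j) * G i (fst z)))) \<in> borel_measurable (?D \<Otimes>\<^sub>M ?L)" for m
      by (intro borel_measurable_divide borel_measurable_add borel_measurable_sum borel_measurable_times
          borel_measurable_const comp src measurable_compose[OF measurable_fst G_meas]) auto
    then have "(\<lambda>z. snd z (Fading 0 j) /
      (inverse SNR + (\<Sum>i=1..N (fst z). snd z (Access i) * snd z (Fading i j) * G i (fst z)))) \<in> borel_measurable (?D \<Otimes>\<^sub>M ?L)"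
      by (rule measurable_compose_countable) (rule measurable_compose[OF measurable_fst N_meas])
    from measurable_compose[OF this, of "indicator {..\<beta>}" borel] show ?thesis
      by (simp add: f_def[abs_def] indicator_def case_prod_beta')
  qed
  have f_V: "f (\<omega>, V \<omega>') = indicator {\<omega>' \<in> space P. g 0 j \<omega>' /
      (inverse SNR + (\<Sum>i=1..N \<omega>. of_bool (act i \<omega>') * g i j \<omega>' * G i \<omega>)) \<le> \<beta>} \<omega>'"
    if "\<omega>' \<in> space P" for \<omega> \<omega>'
    using that by (simp add: f_def indicator_def)
  \<comment> \<open>The mask in \<open>G\<close> is invisible in sums that stop at
    \<open>N \<omega>\<close>.\<close>
  have G_r: "(\<Sum>i=1..N \<omega>. h i * G i \<omega>) = (\<Sum>i=1..N \<omega>. h i * r i j \<omega> powr (- \<alpha>))" for h \<omega>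
    by (rule sum.cong) (auto simp: G_def)
  have cond: "AE \<omega> in P. real_cond_exp P ?D (\<lambda>\<omega>. f (\<omega>, V \<omega>)) \<omega> = expectation (\<lambda>\<omega>'. f (\<omega>, V \<omega>'))"
    using indep_set_distance_link[OF j, folded V_def]
    by (intro real_cond_exp_freezing[where B=1 and T="?L"] subalgebra_distance V_meas f_meas)
      (simp_all add: f_def)
  have const: "expectation (\<lambda>\<omega>'. f (\<omega>, V \<omega>')) =
    1 - exp (- (\<beta> / SNR)) * (\<Prod>i=1..N \<omega>. 1 - pr i + pr i / (1 + \<beta> * r i j \<omega> powr (- \<alpha>)))" for \<omega>
  proof -
    have "expectation (\<lambda>\<omega>'. f (\<omega>, V \<omega>')) = expectation (indicator {\<omega>' \<in> space P. g 0 j \<omega>' /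
      (inverse SNR + (\<Sum>i=1..N \<omega>. of_bool (act i \<omega>') * g i j \<omega>' * G i \<omega>)) \<le> \<beta>})"
      by (rule Bochner_Integration.integral_cong[OF refl f_V])
    also have "\<dots> = prob {\<omega>' \<in> space P. g 0 j \<omega>' /
      (inverse SNR + (\<Sum>i=1..N \<omega>. of_bool (act i \<omega>') * g i j \<omega>' * G i \<omega>)) \<le> \<beta>}"
      by (simp add: Int_absorb2 subset_iff)
    also have "\<dots> = 1 - exp (- (\<beta> / SNR)) * (\<Prod>i=1..N \<omega>. 1 - pr i + pr i / (1 + \<beta> * G i \<omega>))"
      by (rule prob_outage_fixed_gains[OF j]) (simp add: G_def)
    also have "(\<Prod>i=1..N \<omega>. 1 - pr i + pr i / (1 + \<beta> * G i \<omega>)) =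
        (\<Prod>i=1..N \<omega>. 1 - pr i + pr i / (1 + \<beta> * r i j \<omega> powr (- \<alpha>)))"
      by (rule prod.cong) (auto simp: G_def)
    finally show ?thesis .
  qed
  have outage: "AE \<omega> in P. real_cond_exp P ?D (\<lambda>\<omega>. f (\<omega>, V \<omega>)) \<omega> =
      outage_prob P \<alpha> \<beta> SNR N r g act j \<omega>"
  proof -
    interpret finite_measure_subalgebra P ?D
      by unfold_locales (rule subalgebra_distance)
    have eq: "f (\<omega>, V \<omega>) = indicator {\<omega> \<in> space P. sinr \<alpha> SNR N r g act j \<omega> \<le> \<beta>} \<omega>" if "\<omega> \<in> space P" for \<omega>
      using f_V[OF that, of \<omega>] that unfolding G_r by (simp add: sinr_def indicator_def)
    have "(\<lambda>\<omega>. \<omega>) \<in> measurable P ?D"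
      using measurable_from_subalg[OF subalgebra_distance measurable_ident] by (simp add: id_def)
    then have meas: "(\<lambda>\<omega>. f (\<omega>, V \<omega>)) \<in> borel_measurable P"
      by (intro measurable_compose[OF measurable_Pair f_meas] V_meas)
    have meas': "(indicator {\<omega> \<in> space P. sinr \<alpha> SNR N r g act j \<omega> \<le> \<beta>} :: 'a \<Rightarrow> real) \<in> borel_measurable P"
      by (rule measurable_cong[THEN iffD1, OF eq meas])
    show ?thesis
      unfolding outage_prob_def by (rule real_cond_exp_cong[OF _ meas meas']) (simp add: eq)
  qed
  show ?thesis
    using cond outage by eventually_elim (simp add: const)
qed

end

section \<open>Averaging over a Poisson number\<close>

text \<open>Splitting along the events \<open>N \<omega> = m\<close> gives the sum of
  \<open>exp (- lam) * (lam * q) ^ m / fact m\<close>, an exponential series. Nonnegative integrals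
  allow the sum and the integral to be exchanged.\<close>

lemma (in prob_space) integral_poisson_mixture:
  fixes Z :: "'a \<Rightarrow> real"
  assumes number: "distr M (count_space UNIV) N = measure_pmf (poisson_pmf lam)" and lam: "lam > 0"
    and N [measurable]: "random_variable (count_space UNIV) N"
    and Z [measurable]: "random_variable borel Z" and bounds: "\<And>\<omega>. 0 \<le> Z \<omega>" "\<And>\<omega>. Z \<omega> \<le> B"
    and cond: "\<And>m. (\<integral>\<omega>. Z \<omega> \<partial>uniform_measure M {\<omega> \<in> space M. N \<omega> = m}) = q ^ m" and q: "q \<ge> 0"
  shows "expectation Z = exp (- lam * (1 - q))"
proof -
  define A where "A m = {\<omega> \<in> space M. N \<omega> = m}" for m
  have A_meas [measurable]: "A m \<in> sets M" for m unfolding A_def by measurable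
  have emA: "emeasure M (A m) = ennreal (lam ^ m / fact m * exp (- lam))" for m
  proof -
    have "emeasure M (A m) = emeasure (distr M (count_space UNIV) N) {m}"
      by (subst emeasure_distr) (auto simp: A_def intro!: arg_cong[where f="emeasure M"])
    then show ?thesis using lam by (simp add: number emeasure_pmf_single)
  qed
  have part: "(\<integral>\<^sup>+\<omega>. ennreal (Z \<omega>) * indicator (A m) \<omega> \<partial>M) =
      ennreal (exp (- lam) * (inverse (fact m) * (lam * q) ^ m))" for m
  proof -
    have pos: "emeasure M (A m) \<noteq> 0" using lam by (simp add: emA)
    interpret U: prob_space "uniform_measure M (A m)"
      by (rule prob_space_uniform_measure) (use pos in auto)
    have "integrable (uniform_measure M (A m)) Z"
      by (rule U.integrable_const_bound[where B=B]) (use bounds in auto)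
    then have "(\<integral>\<^sup>+\<omega>. ennreal (Z \<omega>) \<partial>uniform_measure M (A m)) = ennreal (q ^ m)"
      using cond[of m] bounds by (simp add: nn_integral_eq_integral A_def)
    then have quot: "(\<integral>\<^sup>+\<omega>. ennreal (Z \<omega>) * indicator (A m) \<omega> \<partial>M) / emeasure M (A m) = ennreal (q ^ m)"
      by (simp add: nn_integral_uniform_measure)
    \<comment> \<open>The factor inserted here equals 1 because the Poisson weight is positive and
      finite; it undoes the normalization in \<open>uniform_measure\<close>.\<close>
    have "(\<integral>\<^sup>+\<omega>. ennreal (Z \<omega>) * indicator (A m) \<omega> \<partial>M) =
        (\<integral>\<^sup>+\<omega>. ennreal (Z \<omega>) * indicator (A m) \<omega> \<partial>M) * (emeasure M (A m) / emeasure M (A m))"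
      using pos by (simp add: ennreal_divide_self less_top[symmetric])
    also have "\<dots> = ennreal (q ^ m) * emeasure M (A m)"
      by (simp add: quot flip: ennreal_divide_times)
    also have "\<dots> = ennreal (q ^ m * (lam ^ m / fact m * exp (- lam)))"
      unfolding emA using lam q by (intro ennreal_mult[symmetric]) auto
    also have "q ^ m * (lam ^ m / fact m * exp (- lam)) = exp (- lam) * (inverse (fact m) * (lam * q) ^ m)"
      by (simp add: power_mult_distrib divide_inverse)
    finally show ?thesis .
  qed
  have "(\<integral>\<^sup>+\<omega>. ennreal (Z \<omega>) \<partial>M) = (\<integral>\<^sup>+\<omega>. (\<Sum>m. ennreal (Z \<omega>) * indicator (A m) \<omega>) \<partial>M)"
  proof (rule nn_integral_cong)
    fix \<omega> assume "\<omega> \<in> space M"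
    \<comment> \<open>The events partition the space, so only the term with
      \<open>m = N \<omega>\<close> survives.\<close>
    have "(\<lambda>m. ennreal (Z \<omega>) * indicator (A m) \<omega>) = (\<lambda>m. if m = N \<omega> then ennreal (Z \<omega>) else 0)"
      using \<open>\<omega> \<in> space M\<close> by (auto simp: A_def)
    then show "ennreal (Z \<omega>) = (\<Sum>m. ennreal (Z \<omega>) * indicator (A m) \<omega>)"
      using sums_single[of "N \<omega>" "\<lambda>_. ennreal (Z \<omega>)"] by (simp add: sums_iff)
  qed
  also have "\<dots> = (\<Sum>m. ennreal (exp (- lam) * (inverse (fact m) * (lam * q) ^ m)))"
    by (subst nn_integral_suminf) (simp_all add: part)
  also have "\<dots> = ennreal (\<Sum>m. exp (- lam) * (inverse (fact m) * (lam * q) ^ m))"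
    using lam q by (intro suminf_ennreal2 summable_mult summable_exp) auto
  also have "(\<Sum>m. exp (- lam) * (inverse (fact m) * (lam * q) ^ m)) = exp (- lam) * exp (lam * q)"
  proof -
    have "(\<Sum>m. inverse (fact m) * (lam * q) ^ m) = exp (lam * q)"
      by (simp add: exp_def)
    then show ?thesis by (simp only: suminf_mult[OF summable_exp])
  qed
  also have "\<dots> = exp (- lam * (1 - q))"
    by (simp add: mult_exp_exp algebra_simps)
  finally show ?thesis
    using bounds by (simp add: integral_eq_nn_integral)
qed

section \<open>The distance density and the cluster integrals\<close>

text \<open>All terms are even powers with positive coefficients. Summability comes from the
  exponential series at \<open>(x / 2)\<^sup>2\<close>, using
  \<open>fact k \<le> (fact k)\<^sup>2\<close>.\<close>

lemma bessel_I0_nonneg: "bessel_I0 x \<ge> 0"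
proof -
  have "summable (\<lambda>k. (x / 2) ^ (2 * k) / (fact k)\<^sup>2)"
  proof (rule summable_comparison_test)
    have "norm ((x / 2) ^ (2 * k) / (fact k)\<^sup>2) \<le> inverse (fact k) * ((x / 2)\<^sup>2) ^ k" for k
    proof -
      have "fact k \<le> (fact k :: real)\<^sup>2" by (rule self_le_power) auto
      then have "((x / 2)\<^sup>2) ^ k / (fact k)\<^sup>2 \<le> ((x / 2)\<^sup>2) ^ k / fact k"
        by (intro divide_left_mono) auto
      then show ?thesis
        unfolding power_mult[of "x / 2" 2 k] by (simp add: divide_inverse[of _ "fact k"] mult.commute)
    qed
    then show "\<exists>n0. \<forall>k\<ge>n0. norm ((x / 2) ^ (2 * k) / (fact k)\<^sup>2) \<le> inverse (fact k) * ((x / 2)\<^sup>2) ^ k"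
      by blast
  qed (rule summable_exp)
  then show ?thesis unfolding bessel_I0_def by (rule suminf_nonneg) simp
qed

lemma dist_density_nonneg: "dist_density \<sigma> \<nu> x \<ge> 0"
  by (simp add: dist_density_def bessel_I0_nonneg)

text \<open>The density vanishes on the negative half-line, so the domain can be extended to all
  reals.\<close>

lemma set_integral_dist_density:
  "(LBINT x:{0..}. dist_density \<sigma> \<nu> x * f x) = (LBINT x. dist_density \<sigma> \<nu> x * f x)"
  "(LBINT x:{0..}. f x * dist_density \<sigma> \<nu> x) = (LBINT x. dist_density \<sigma> \<nu> x * f x)"
  unfolding set_lebesgue_integral_def
  by (rule Bochner_Integration.integral_cong; simp add: dist_density_def indicator_def)+

text \<open>Expand the square of \<open>1 - p + p * k x\<close>. Since \<open>k\<close> has values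
  in \<open>[0, 1]\<close>, each term is dominated by the density and may be integrated separately;
  the constant term uses total mass 1.\<close>

lemma cluster_Q_expand:
  assumes int: "integrable lborel (dist_density \<sigma> \<nu>)" and norm: "(LBINT x. dist_density \<sigma> \<nu> x) = 1"
    and beta: "\<beta> > 0"
  shows "cluster_Q \<alpha> \<beta> p \<nu> \<sigma> =
    (1 - p)\<^sup>2 + 2 * (1 - p) * p * cluster_V \<alpha> \<beta> \<nu> \<sigma> + p\<^sup>2 * cluster_C \<alpha> \<beta> \<nu> \<sigma>"
proof -
  let ?d = "dist_density \<sigma> \<nu>"
  define k where "k x = x powr \<alpha> / (\<beta> + x powr \<alpha>)" for x
  have k: "0 \<le> k x" "k x \<le> 1" for x
    using beta by (simp_all add: k_def add_pos_nonneg)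
  have [measurable]: "k \<in> borel_measurable borel" "?d \<in> borel_measurable lborel"
    using int by (auto simp: k_def[abs_def])
  have int_k: "integrable lborel (\<lambda>x. ?d x * k x ^ n)" for n
  proof (rule Bochner_Integration.integrable_bound[OF int])
    show "AE x in lborel. norm (?d x * k x ^ n) \<le> norm (?d x)"
      using k by (intro AE_I2) (simp add: abs_mult power_le_one mult_left_le)
  qed measurable
  have V: "(LBINT x. ?d x * k x ^ 1) = cluster_V \<alpha> \<beta> \<nu> \<sigma>"
    unfolding cluster_V_def set_integral_dist_density by (simp add: k_def)
  have "x powr (2 * \<alpha>) / (\<beta> + x powr \<alpha>)\<^sup>2 = k x ^ 2" for x
    unfolding k_def power_divide by (simp only: mult_2 powr_add power2_eq_square)
  then have C: "(LBINT x. ?d x * k x ^ 2) = cluster_C \<alpha> \<beta> \<nu> \<sigma>"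
    unfolding cluster_C_def set_integral_dist_density by simp
  have "cluster_Q \<alpha> \<beta> p \<nu> \<sigma> = (LBINT x. ?d x * (1 - p + p * k x)\<^sup>2)"
    unfolding cluster_Q_def set_integral_dist_density by (simp add: k_def)
  also have "\<dots> = (LBINT x. (1 - p)\<^sup>2 * ?d x + 2 * (1 - p) * p * (?d x * k x ^ 1) + p\<^sup>2 * (?d x * k x ^ 2))"
    by (rule Bochner_Integration.integral_cong) (simp_all add: power2_eq_square algebra_simps)
  also have "\<dots> = (1 - p)\<^sup>2 + 2 * (1 - p) * p * (LBINT x. ?d x * k x ^ 1) + p\<^sup>2 * (LBINT x. ?d x * k x ^ 2)"
    using int int_k[of 1] int_k[of 2] norm by simp
  finally show ?thesis unfolding V C .
qed

section \<open>Second moment of the conditional outage probability\<close>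

theorem theorem5:
  fixes P :: "'a measure"
    and r0 \<theta> \<alpha> \<beta> SNR p lam \<sigma> \<nu> :: real
    and N :: "'a \<Rightarrow> nat"
    and X :: "nat \<Rightarrow> 'a \<Rightarrow> complex"
    and Y :: "nat \<Rightarrow> complex"
    and r g :: "nat \<Rightarrow> nat \<Rightarrow> 'a \<Rightarrow> real"
    and act :: "nat \<Rightarrow> 'a \<Rightarrow> bool"
    and j :: nat
  assumes network: "interference_network P r0 \<theta> \<alpha> \<beta> SNR (\<lambda>_. p) N X Y r g act"
    and p: "p \<in> {0..1}"
    and lam: "lam > 0" and sigma: "\<sigma> > 0" and nu: "\<nu> \<ge> 0"
    and receiver: "j \<in> {1, 2}"
    and number: "distr P (count_space UNIV) N = measure_pmf (poisson_pmf lam)"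
    and distances_indep: "\<And>m. prob_space.indep_vars
          (uniform_measure P {\<omega> \<in> space P. N \<omega> = m}) (\<lambda>_. borel) (\<lambda>i. r i j) {1..m}"
    and distances_density: "\<And>m i. i \<in> {1..m} \<Longrightarrow>
          distributed (uniform_measure P {\<omega> \<in> space P. N \<omega> = m}) lborel (r i j)
            (\<lambda>x. ennreal (dist_density \<sigma> \<nu> x))"
  shows "(\<integral>\<omega>. (outage_prob P \<alpha> \<beta> SNR N r g act j \<omega>)\<^sup>2 \<partial>P) =
           2 * (\<integral>\<omega>. outage_prob P \<alpha> \<beta> SNR N r g act j \<omega> \<partial>P) - 1
           + exp (- (2 * \<beta> / SNR) - lam * (1 - cluster_Q \<alpha> \<beta> p \<nu> \<sigma>)) \<and>
         cluster_Q \<alpha> \<beta> p \<nu> \<sigma> =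
           (1 - p)\<^sup>2 + 2 * (1 - p) * p * cluster_V \<alpha> \<beta> \<nu> \<sigma> + p\<^sup>2 * cluster_C \<alpha> \<beta> \<nu> \<sigma>"
proof
  interpret interference_network P r0 \<theta> \<alpha> \<beta> SNR "\<lambda>_. p" N X Y r g act by (rule network)
  define U where "U m = uniform_measure P {\<omega> \<in> space P. N \<omega> = m}" for m
  have U: "prob_space (U m)" for m
    unfolding U_def
  proof (rule prob_space_uniform_measure)
    \<comment> \<open>Every Poisson weight is positive for positive \<open>lam\<close>, so
      conditioning on \<open>N \<omega> = m\<close> yields a probability measure for every
      \<open>m\<close>, including 0.\<close>
    have "emeasure (distr P (count_space UNIV) N) {m} \<noteq> 0"
      using lam by (simp add: number emeasure_pmf_single)
    moreover have "N -` {m} \<inter> space P = {\<omega> \<in> space P. N \<omega> = m}" by auto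
    ultimately show "emeasure P {\<omega> \<in> space P. N \<omega> = m} \<noteq> 0"
      by (simp add: emeasure_distr[OF number_rv])
  qed simp
  have density: "distributed (U m) lborel (r i j) (dist_density \<sigma> \<nu>)" if "i \<in> {1..m}" for i m
    using distances_density[OF that] by (simp add: U_def)
  \<comment> \<open>Given exactly one interferer, its distance has density
    \<open>dist_density \<sigma> \<nu>\<close>. Integrability and total mass 1 are thus inherited
    from a probability law, and no Bessel integral has to be evaluated.\<close>
  interpret U1: prob_space "U (Suc 0)" by (rule U)
  have one: "distributed (U (Suc 0)) lborel (r 1 j) (dist_density \<sigma> \<nu>)" by (rule density) simp
  have "integrable lborel (dist_density \<sigma> \<nu>)" "(LBINT x. dist_density \<sigma> \<nu> x) = 1"
    using distributed_integrable[OF one, of "\<lambda>_. 1 :: real"] distributed_integral[OF one, of "\<lambda>_. 1 :: real"]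
    by (simp_all add: dist_density_nonneg U1.prob_space)
  then show "cluster_Q \<alpha> \<beta> p \<nu> \<sigma> =
      (1 - p)\<^sup>2 + 2 * (1 - p) * p * cluster_V \<alpha> \<beta> \<nu> \<sigma> + p\<^sup>2 * cluster_C \<alpha> \<beta> \<nu> \<sigma>"
    using beta_pos by (rule cluster_Q_expand)

  define h where "h x = 1 - p + p / (1 + \<beta> * x powr (- \<alpha>))" for x
  define T where "T \<omega> = (\<Prod>i=1..N \<omega>. h (r i j \<omega>))" for \<omega>
  define c where "c = exp (- (\<beta> / SNR))"
  have h_bounds: "0 \<le> h x" "h x \<le> 1" for x
  proof -
    have "1 / (1 + \<beta> * x powr (- \<alpha>)) \<le> 1"
      using beta_pos by (intro divide_le_eq_1_pos[THEN iffD2]) (simp_all add: add_pos_nonneg)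
    then have "p * (1 / (1 + \<beta> * x powr (- \<alpha>))) \<le> p" using p by (intro mult_left_le) auto
    then show "h x \<le> 1" by (simp add: h_def)
    show "0 \<le> h x" using p beta_pos by (simp add: h_def)
  qed
  have T_bounds: "0 \<le> T \<omega>" "T \<omega> \<le> 1" for \<omega>
    unfolding T_def using h_bounds by (auto intro!: prod_nonneg prod_le_1)
  have [measurable]: "h \<in> borel_measurable borel" unfolding h_def[abs_def] by measurable
  have r_meas: "r i j \<in> borel_measurable P" if "i \<ge> 1" for i
  proof -
    note [measurable] = position_rv[OF that]
    show ?thesis unfolding distance[abs_def] by measurable
  qed
  have T_meas [measurable]: "T \<in> borel_measurable P"
  proof -
    have "(\<lambda>\<omega>. \<Prod>i=1..m. h (r i j \<omega>)) \<in> borel_measurable P" for m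
      by (intro borel_measurable_prod measurable_compose[OF r_meas]) auto
    then show ?thesis unfolding T_def[abs_def]
      by (rule measurable_compose_countable) (rule number_rv)
  qed
  have outage: "AE \<omega> in P. outage_prob P \<alpha> \<beta> SNR N r g act j \<omega> = 1 - c * T \<omega>"
    using outage_prob_eq[OF receiver] by (simp add: c_def T_def h_def)

  define Q where "Q = cluster_Q \<alpha> \<beta> p \<nu> \<sigma>"
  have Q: "(LBINT x. dist_density \<sigma> \<nu> x * (h x)\<^sup>2) = Q"
  proof -
    \<comment> \<open>The two forms of the factor agree for \<open>x > 0\<close>; for all other
      \<open>x\<close>, including 0, the density is zero.\<close>
    have eq: "dist_density \<sigma> \<nu> x * (h x)\<^sup>2 =
        dist_density \<sigma> \<nu> x * (1 - p + p * x powr \<alpha> / (\<beta> + x powr \<alpha>))\<^sup>2" for x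
    proof (cases "x > 0")
      case True
      then have "h x = 1 - p + p * x powr \<alpha> / (\<beta> + x powr \<alpha>)"
        by (simp add: h_def powr_minus divide_simps add.commute)
      then show ?thesis by simp
    qed (auto simp: dist_density_def)
    show ?thesis unfolding eq by (simp only: Q_def cluster_Q_def set_integral_dist_density)
  qed
  have "(\<integral>\<omega>. (T \<omega>)\<^sup>2 \<partial>U m) = Q ^ m" for m
  proof -
    interpret Um: prob_space "U m" by (rule U)
    have sets_U: "sets (U m) = sets P" by (simp add: U_def)
    have meas: "(\<lambda>\<omega>. (h (r i j \<omega>))\<^sup>2) \<in> borel_measurable (U m)" if "i \<in> {1..m}" for i
    proof -
      have "r i j \<in> borel_measurable (U m)"
        using r_meas[of i] that by (simp add: measurable_cong_sets[OF sets_U refl])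
      then show ?thesis by measurable
    qed
    \<comment> \<open>Under \<open>U m\<close> the random index range of \<open>T\<close> becomes
      the fixed set \<open>{1..m}\<close>, on which conditional independence is available.\<close>
    have "AE \<omega> in U m. N \<omega> = m"
      unfolding U_def using number_rv by (intro AE_uniform_measureI) auto
    then have AE_T: "AE \<omega> in U m. (T \<omega>)\<^sup>2 = (\<Prod>i=1..m. (h (r i j \<omega>))\<^sup>2)"
      by eventually_elim (simp add: T_def prod_power_distrib)
    have "(\<lambda>\<omega>. (T \<omega>)\<^sup>2) \<in> borel_measurable (U m)"
      unfolding measurable_cong_sets[OF sets_U refl] by measurable
    then have "(\<integral>\<omega>. (T \<omega>)\<^sup>2 \<partial>U m) = (\<integral>\<omega>. (\<Prod>i=1..m. (h (r i j \<omega>))\<^sup>2) \<partial>U m)"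
      by (rule integral_cong_AE[OF _ borel_measurable_prod[OF meas] AE_T])
    also have "\<dots> = (\<Prod>i=1..m. \<integral>\<omega>. (h (r i j \<omega>))\<^sup>2 \<partial>U m)"
    proof (rule Um.indep_vars_lebesgue_integral)
      show "Um.indep_vars (\<lambda>_. borel) (\<lambda>i \<omega>. (h (r i j \<omega>))\<^sup>2) {1..m}"
        using distances_indep[of m, folded U_def] by (rule Um.indep_vars_compose2) measurable
      show "integrable (U m) (\<lambda>\<omega>. (h (r i j \<omega>))\<^sup>2)" if "i \<in> {1..m}" for i
        by (rule Um.integrable_const_bound[where B=1])
          (use meas[OF that] h_bounds in \<open>auto simp: power_le_one\<close>)
    qed simp
    also have "\<dots> = (\<Prod>i=1..m. Q)"
    proof (rule prod.cong)
      fix i assume "i \<in> {1..m}"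
      from distributed_integral[OF density[OF this], of "\<lambda>x. (h x)\<^sup>2"]
      show "(\<integral>\<omega>. (h (r i j \<omega>))\<^sup>2 \<partial>U m) = Q"
        by (simp add: dist_density_nonneg Q)
    qed simp
    finally show ?thesis by simp
  qed
  moreover have "Q \<ge> 0"
    unfolding Q[symmetric] by (intro Bochner_Integration.integral_nonneg) (simp add: dist_density_nonneg)
  \<comment> \<open>The conditional moments \<open>Q ^ m\<close> have the form required by the
    Poisson mixture, with \<open>q = Q\<close> and \<open>Z\<close> the square of
    \<open>T\<close>.\<close>
  ultimately have ET2: "expectation (\<lambda>\<omega>. (T \<omega>)\<^sup>2) = exp (- lam * (1 - Q))"
    using T_bounds
    by (intro integral_poisson_mixture[OF number lam number_rv, where B=1])
      (auto simp: U_def power_le_one)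

  have int_T: "integrable P T"
    by (rule integrable_const_bound[where B=1]) (use T_bounds in auto)
  have int_T2: "integrable P (\<lambda>\<omega>. (T \<omega>)\<^sup>2)"
    by (rule integrable_const_bound[where B=1]) (use T_bounds in \<open>auto simp: power_le_one\<close>)
  have out_meas [measurable]: "outage_prob P \<alpha> \<beta> SNR N r g act j \<in> borel_measurable P"
    unfolding outage_prob_def by (rule borel_measurable_cond_exp2)
  have E1: "expectation (outage_prob P \<alpha> \<beta> SNR N r g act j) = 1 - c * expectation T"
  proof -
    have "expectation (outage_prob P \<alpha> \<beta> SNR N r g act j) = expectation (\<lambda>\<omega>. 1 - c * T \<omega>)"
      by (rule integral_cong_AE[OF _ _ outage]) measurable
    then show ?thesis using int_T by (simp add: prob_space)
  qed
  \<comment> \<open>The linear term is not evaluated: by \<open>E1\<close>, the expectation of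
    \<open>T\<close> can be re-expressed through the mean outage probability.\<close>
  have "AE \<omega> in P. (outage_prob P \<alpha> \<beta> SNR N r g act j \<omega>)\<^sup>2 = 1 - 2 * c * T \<omega> + c\<^sup>2 * (T \<omega>)\<^sup>2"
    using outage
  proof eventually_elim
    case (elim \<omega>)
    show ?case unfolding elim by (simp add: power2_eq_square algebra_simps)
  qed
  then have "expectation (\<lambda>\<omega>. (outage_prob P \<alpha> \<beta> SNR N r g act j \<omega>)\<^sup>2) =
      expectation (\<lambda>\<omega>. 1 - 2 * c * T \<omega> + c\<^sup>2 * (T \<omega>)\<^sup>2)"
    by (rule integral_cong_AE[rotated 2]) measurable
  also have "\<dots> = 1 - 2 * c * expectation T + c\<^sup>2 * exp (- lam * (1 - Q))"
    using int_T int_T2 by (simp add: prob_space ET2)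
  also have "c\<^sup>2 * exp (- lam * (1 - Q)) = exp (- (2 * \<beta> / SNR) - lam * (1 - Q))"
    by (simp add: c_def power2_eq_square mult_exp_exp)
  finally show "(\<integral>\<omega>. (outage_prob P \<alpha> \<beta> SNR N r g act j \<omega>)\<^sup>2 \<partial>P) =
      2 * (\<integral>\<omega>. outage_prob P \<alpha> \<beta> SNR N r g act j \<omega> \<partial>P) - 1
      + exp (- (2 * \<beta> / SNR) - lam * (1 - cluster_Q \<alpha> \<beta> p \<nu> \<sigma>))"
    by (simp add: E1 Q_def)
qed

end
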